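(* Let $n$ be an odd positive integer, $q=2^n$, and $g(y)=y^2+y$ for $y\in\mathbb{F}_q$. In the plane $\Pi(\mathbb{K}_n)$ the set $$\mathcal{O}_g=\{(g(y),y): y\in\mathbb{F}_q\}\cup\{(0),(1)\}$$ is a translation hyperoval. Furthermore, $\mathcal{O}_g$ is not equivalent to the standard hyperoval $\mathcal{O}_s=\{(x,x*x): x\in\mathbb{F}_q\}\cup\{(0),(\infty)\}$.
   Context: For odd $n$ and $q=2^n$, let $\mathrm{Tr}:\mathbb{F}_q\to\mathbb{F}_2$ be the absolute trace. Knuth's binary presemifield $\mathbb{K}_n=(\mathbb{F}_q,+,* )$ has multiplication $x*y=xy+\big(y\,\mathrm{Tr}(x)+x\,\mathrm{Tr}(y)\big)^2$. The plane $\Pi(\mathbb{K}_n)$ has affine points $(a,b)$, $a,b\in\mathbb{F}_q$, points at infinity $(a)$, $a\in\mathbb{F}_q\cup\{\infty\}$, and lines: the line at infinity $l_\infty$ (all points $(a)$); $l_a=\{(a,y):y\in\mathbb{F}_q\}\cup\{(\infty)\}$ for $a\in\mathbb{F}_q$; and $l_{a,b}=\{(x,y): y=x*a+b\}\cup\{(a)\}$ for $a,b\in\mathbb{F}_q$. A hyperoval is a set of $q+2$ points no three collinear. A translation hyperoval is a hyperoval for which $l_\infty$ is a secant (meets it in 2 points) and some subgroup of order $q$ of the translation group $\{(x,y)\mapsto(x+a,y+b)\}$ (fixing all points at infinity) acts regularly on its $q$ affine points. Two hyperovals are equivalent if some collineation of the plane maps one onto the other.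
   Formalization: The non-equivalence of O_g and O_s is stated only for odd n ≥ 5; for n = 1 and n = 3 it is false, since the plane is then the Desarguesian plane of order 2 or 8, in which all hyperovals are equivalent. *)

theory Defs
  imports "HOL-Library.Cardinality" "HOL-Algebra.Group"
begin

text \<open>The field with \<open>2 ^ n\<close> elements is rendered as a type \<open>'a :: {field, finite}\<close> with
  \<open>CARD('a) = 2 ^ n\<close>. Its prime field is \<open>{0, 1}\<close>, so the absolute trace
  is an \<open>'a\<close>-valued function.\<close>

definition abs_trace :: "nat \<Rightarrow> 'a::{field,finite} \<Rightarrow> 'a" where
  "abs_trace n x = (\<Sum>i<n. x ^ (2 ^ i))"

definition knuth_mult :: "nat \<Rightarrow> 'a::{field,finite} \<Rightarrow> 'a \<Rightarrow> 'a" where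
  "knuth_mult n x y = x * y + (y * abs_trace n x + x * abs_trace n y)\<^sup>2"

text \<open>\<open>Slope a\<close> is the point \<open>(a)\<close> at infinity, \<open>Vertex\<close> is the point \<open>(\<infinity>)\<close>.
  Lines are identified with their point sets.\<close>

datatype 'a point = Affine 'a 'a | Slope 'a | Vertex

definition line_inf :: "'a point set" where
  "line_inf = range Slope \<union> {Vertex}"

definition vertical_line :: "'a \<Rightarrow> 'a point set" where
  "vertical_line a = {Affine a y | y. True} \<union> {Vertex}"

definition sloped_line ::
  "('a::{field,finite} \<Rightarrow> 'a \<Rightarrow> 'a) \<Rightarrow> 'a \<Rightarrow> 'a \<Rightarrow> 'a point set" where
  "sloped_line m a b = {Affine x y | x y. y = m x a + b} \<union> {Slope a}"

definition plane_lines ::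
  "('a::{field,finite} \<Rightarrow> 'a \<Rightarrow> 'a) \<Rightarrow> 'a point set set" where
  "plane_lines m = {line_inf} \<union> range vertical_line \<union> {sloped_line m a b | a b. True}"

definition hyperoval ::
  "('a::{field,finite} \<Rightarrow> 'a \<Rightarrow> 'a) \<Rightarrow> 'a point set \<Rightarrow> bool" where
  "hyperoval m H \<longleftrightarrow> card H = CARD('a) + 2 \<and>
     (\<forall>P\<in>H. \<forall>Q\<in>H. \<forall>R\<in>H. P \<noteq> Q \<longrightarrow> P \<noteq> R \<longrightarrow> Q \<noteq> R \<longrightarrow>
        \<not> (\<exists>l\<in>plane_lines m. P \<in> l \<and> Q \<in> l \<and> R \<in> l))"

fun plane_translation :: "'a::{field,finite} \<Rightarrow> 'a \<Rightarrow> 'a point \<Rightarrow> 'a point" where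
  "plane_translation a b (Affine x y) = Affine (x + a) (y + b)"
| "plane_translation a b (Slope c) = Slope c"
| "plane_translation a b Vertex = Vertex"

definition translation_group :: "('a::{field,finite} point \<Rightarrow> 'a point) monoid" where
  "translation_group =
     \<lparr>carrier = {plane_translation a b | a b. True}, mult = (\<circ>), one = id\<rparr>"

definition acts_regularly_on :: "('p \<Rightarrow> 'p) set \<Rightarrow> 'p set \<Rightarrow> bool" where
  "acts_regularly_on T S \<longleftrightarrow>
     (\<forall>t\<in>T. t ` S = S) \<and> (\<forall>P\<in>S. \<forall>Q\<in>S. \<exists>!t. t \<in> T \<and> t P = Q)"

definition translation_hyperoval ::
  "('a::{field,finite} \<Rightarrow> 'a \<Rightarrow> 'a) \<Rightarrow> 'a point set \<Rightarrow> bool" where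
  "translation_hyperoval m H \<longleftrightarrow> hyperoval m H \<and> card (H \<inter> line_inf) = 2 \<and>
     (\<exists>T. subgroup T translation_group \<and> card T = CARD('a) \<and>
          acts_regularly_on T (H - line_inf))"

definition collineation ::
  "('a::{field,finite} \<Rightarrow> 'a \<Rightarrow> 'a) \<Rightarrow> ('a point \<Rightarrow> 'a point) \<Rightarrow> bool" where
  "collineation m f \<longleftrightarrow> bij f \<and> (`) f ` plane_lines m = plane_lines m"

definition equivalent_in_plane ::
  "('a::{field,finite} \<Rightarrow> 'a \<Rightarrow> 'a) \<Rightarrow> 'a point set \<Rightarrow> 'a point set \<Rightarrow> bool" where
  "equivalent_in_plane m H H' \<longleftrightarrow> (\<exists>f. collineation m f \<and> f ` H = H')"

definition O_g :: "'a::{field,finite} point set" where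
  "O_g = {Affine (y\<^sup>2 + y) y | y. True} \<union> {Slope 0, Slope 1}"

definition O_s :: "('a::{field,finite} \<Rightarrow> 'a \<Rightarrow> 'a) \<Rightarrow> 'a point set" where
  "O_s m = {Affine x (m x x) | x. True} \<union> {Slope 0, Vertex}"

end

theory Submission
  imports Defs "HOL-Number_Theory.Residues"
begin

text \<open>Along a line of slope \<open>a\<close>, two points of \<open>O_g\<close> differ by a nonzero solution \<open>d\<close> of
  \<open>d = g d * a\<close>, and it suffices that there is at most one. If \<open>Tr a = 0\<close> the equation is linear
  after division by \<open>d\<close>. If \<open>Tr a = 1\<close> it is a cubic, each of whose roots has
  \<open>Tr (1 / (d + 1)) = Tr a = 1\<close>; a second root \<open>e\<close> would satisfy
  \<open>(e / d)\<^sup>2 + e / d = 1 / (d + 1)\<close>, whose left-hand side has trace 0.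

  For the inequivalence, \<open>Vertex\<close> is a point such that for every axis through it the group of
  elations with that centre and axis acts transitively, and \<open>Vertex\<close> lies on \<open>O_s\<close> but not on
  \<open>O_g\<close>. If an equivalence existed, some other point would have this property too, hence by moving
  it around \<open>Slope 0\<close> would. The elation with centre \<open>Slope 0\<close>, axis \<open>y = 0\<close> and
  \<open>Vertex \<mapsto> Slope s\<close> turns into an identity for the multiplication that fails in Knuth's
  presemifield.\<close>

section \<open>The trace\<close>

text \<open>Multiplication by a nonzero \<open>x\<close> permutes the nonzero elements, so comparing
  the two products of all of them gives \<open>x ^ (q - 1) = 1\<close>, where \<open>q\<close> is
  the field size.\<close>

lemma power_CARD_eq_self:
  fixes x :: "'a::{field,finite}"
  shows "x ^ CARD('a) = x"
proof (cases "x = 0")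
  case False
  let ?U = "UNIV - {0 :: 'a}"
  have "bij_betw ((*) x) ?U ?U"
    by (rule bij_betwI[where g = "\<lambda>y. y / x"]) (use False in auto)
  hence "(\<Prod>y\<in>?U. x * y) = \<Prod>?U"
    by (rule prod.reindex_bij_betw)
  hence "x ^ card ?U = 1"
    by (simp add: prod.distrib)
  moreover have "CARD('a) = Suc (card ?U)"
    by (rule card.remove) simp_all
  ultimately show ?thesis
    by (simp only: power_Suc mult_1_right)
qed simp

locale odd_binary_field =
  fixes n :: nat and ty :: "'a::{field,finite} itself"
  assumes odd_n: "odd n" and card_UNIV: "CARD('a) = 2 ^ n"
begin

abbreviation Tr :: "'a \<Rightarrow> 'a" where "Tr \<equiv> abs_trace n"

lemma CHAR_2: "CHAR('a) = 2"
proof -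
  have "prime CHAR('a)"
    using prime_CHAR_semidom finite_imp_CHAR_pos by (metis finite)
  moreover have "CHAR('a) dvd 2 ^ n"
    using CHAR_dvd_CARD[where ?'a = 'a] card_UNIV by simp
  ultimately show ?thesis
    using prime_dvd_power primes_dvd_imp_eq two_is_prime_nat by blast
qed

lemma two_eq_0: "(2 :: 'a) = 0"
  using of_nat_CHAR[where ?'a = 'a] by (simp add: CHAR_2)

lemma add_self [simp]: "x + x = (0 :: 'a)"
  using two_eq_0 by (metis mult_2 mult_zero_left)

lemma add_self_left [simp]: "x + (x + y) = (y :: 'a)"
  by (simp flip: add.assoc)

lemma add_eq_0_iff_eq: "x + y = 0 \<longleftrightarrow> x = (y :: 'a)"
  by (metis add_self add_left_cancel)

lemma eq_add_iff: "x = y + z \<longleftrightarrow> x + z = (y :: 'a)"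
  by (metis add_self_left add.commute)

lemma add_power2: "(x + y)\<^sup>2 = x\<^sup>2 + (y :: 'a)\<^sup>2"
  by (simp add: power2_sum two_eq_0)

lemma power_CARD: "x ^ (2 ^ n) = (x :: 'a)"
  using power_CARD_eq_self[of x] card_UNIV by simp

lemma Tr_0 [simp]: "Tr 0 = 0"
  by (simp add: abs_trace_def power_0_left)

text \<open>Oddness of \<open>n\<close> enters here: the trace of 1 is a sum of \<open>n\<close>
  ones in characteristic 2.\<close>

lemma Tr_1 [simp]: "Tr 1 = 1"
proof -
  obtain k where "n = 2 * k + 1" using odd_n by (rule oddE)
  thus ?thesis by (simp add: abs_trace_def two_eq_0)
qed

lemma Tr_add: "Tr (x + y) = Tr x + Tr y"
proof -
  have "(x + y) ^ (2 ^ i) = x ^ (2 ^ i) + y ^ (2 ^ i)" for i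
    by (rule freshmans_dream') (simp_all add: CHAR_2)
  thus ?thesis by (simp add: abs_trace_def sum.distrib)
qed

lemma Tr_power2_eq_sum: "Tr (x\<^sup>2) = (\<Sum>i<n. x ^ (2 ^ Suc i))"
  by (simp add: abs_trace_def flip: power_mult)

text \<open>Squaring shifts every exponent by one step; the new last term \<open>x ^ (2 ^ n)\<close>
  equals \<open>x\<close>, the first term that was lost.\<close>

lemma Tr_power2 [simp]: "Tr (x\<^sup>2) = Tr x"
proof -
  have "Tr x + x ^ (2 ^ n) = (\<Sum>i<Suc n. x ^ (2 ^ i))"
    by (simp add: abs_trace_def)
  also have "\<dots> = x + (\<Sum>i<n. x ^ (2 ^ Suc i))"
    by (subst sum.lessThan_Suc_shift) simp
  finally show ?thesis
    by (metis Tr_power2_eq_sum power_CARD add.commute add_right_cancel)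
qed

lemma power2_Tr: "(Tr x)\<^sup>2 = Tr x"
proof -
  have "(\<Sum>i\<in>A. f i)\<^sup>2 = (\<Sum>i\<in>A. (f i :: 'a)\<^sup>2)" for A :: "nat set" and f
    by (rule freshmans_dream_sum) (simp_all add: CHAR_2)
  hence "(Tr x)\<^sup>2 = (\<Sum>i<n. x ^ (2 ^ Suc i))"
    by (simp add: abs_trace_def mult.commute flip: power_mult)
  thus ?thesis by (metis Tr_power2_eq_sum Tr_power2)
qed

lemma Tr_cases: "Tr x = 0 \<or> Tr x = 1"
proof -
  have "Tr x * (Tr x + 1) = 0"
    by (metis power2_Tr add_self distrib_left mult.right_neutral power2_eq_square)
  thus ?thesis by (auto simp: add_eq_0_iff_eq)
qed

text \<open>Otherwise \<open>Tr (c * x)\<close> vanishes on the kernel of \<open>Tr\<close>, hence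
  equals \<open>Tr c * Tr x\<close>, which is \<open>Tr (Tr c * x)\<close>. Nondegeneracy of the
  trace form then gives \<open>c = Tr c\<close>, an element of the prime field.\<close>

lemma Tr_mult_dichotomy:
  assumes "c \<noteq> 0" "c \<noteq> 1"
  obtains x where "Tr x = 0" "Tr (c * x) = 1"
proof (rule ccontr)
  assume "\<not> thesis"
  hence "Tr (c * x) \<noteq> 1" if "Tr x = 0" for x
    using that \<open>\<And>x. Tr x = 0 \<Longrightarrow> Tr (c * x) = 1 \<Longrightarrow> thesis\<close> by metis
  hence *: "Tr (c * x) = 0" if "Tr x = 0" for x
    using that Tr_cases[of "c * x"] by simp
  have "Tr (c * x) = Tr c * Tr x" for x
  proof (cases "Tr x = 0")
    case False
    hence "Tr x = 1" using Tr_cases[of x] by simp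
    hence "Tr (x + 1) = 0" by (simp add: Tr_add)
    hence "Tr (c * (x + 1)) = 0" by (rule *)
    hence "Tr (c * x) + Tr c = 0"
      by (simp add: distrib_left Tr_add)
    hence "Tr (c * x) = Tr c"
      by (simp only: add_eq_0_iff_eq)
    thus ?thesis using \<open>Tr x = 1\<close> by simp
  qed (simp add: *)
  moreover have "Tr (Tr c * x) = Tr c * Tr x" for x
    using Tr_cases[of c] by auto
  ultimately have **: "Tr ((c + Tr c) * x) = 0" for x
    by (simp only: distrib_right Tr_add add_self)
  \<comment> \<open>If it were nonzero, taking \<open>x\<close> to be its inverse would give
    \<open>Tr 1 = 0\<close>.\<close>
  have "c + Tr c = 0"
    using **[of "inverse (c + Tr c)"] Tr_1 by (metis right_inverse zero_neq_one)
  thus False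
    using assms Tr_cases[of c] by (metis add_eq_0_iff_eq)
qed

text \<open>Four translates of the joint kernel cover the field: adding \<open>1\<close> corrects
  \<open>Tr x\<close>, and for nonzero \<open>c\<close> adding \<open>u\<close> corrects
  \<open>Tr (c * x)\<close> without touching \<open>Tr x\<close>. For \<open>c = 0\<close> the
  second condition is vacuous and \<open>u = 0\<close> will do.\<close>

lemma card_common_kernel:
  assumes "c \<noteq> 1"
  shows "2 ^ n \<le> 4 * card {x. Tr x = 0 \<and> Tr (c * x) = 0}"
proof -
  let ?S = "{x. Tr x = 0 \<and> Tr (c * x) = 0}"
  obtain u where u: "Tr u = 0" "c \<noteq> 0 \<Longrightarrow> Tr (c * u) = 1"
    using Tr_mult_dichotomy[of c] assms Tr_0 by metis
  have "UNIV \<subseteq> (\<Union>r\<in>{0, u, 1, 1 + u}. (+) r ` ?S)"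
  proof
    fix x :: 'a
    have "x \<in> ?S \<or> x + u \<in> ?S \<or> x + 1 \<in> ?S \<or> x + (1 + u) \<in> ?S"
      using Tr_cases[of x] Tr_cases[of "c * x"] Tr_cases[of c] u
      by (cases "c = 0"; elim disjE) (simp_all add: Tr_add distrib_left two_eq_0)
    moreover have "x \<in> (+) r ` ?S" if "x + r \<in> ?S" for r
      using that by (intro image_eqI[of _ _ "x + r"]) (auto simp: ac_simps)
    ultimately show "x \<in> (\<Union>r\<in>{0, u, 1, 1 + u}. (+) r ` ?S)"
      by (metis (no_types, lifting) UN_iff add.right_neutral insert_iff)
  qed
  hence "CARD('a) \<le> card (\<Union>r\<in>{0, u, 1, 1 + u}. (+) r ` ?S)"
    by (intro card_mono) auto
  also have "\<dots> \<le> (\<Sum>r\<in>{0, u, 1, 1 + u}. card ((+) r ` ?S))"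
    by (rule card_UN_le) simp
  also have "\<dots> = card {0, u, 1, 1 + u} * card ?S"
    by (simp add: card_image)
  also have "\<dots> \<le> 4 * card ?S"
    by (intro mult_right_mono) (auto simp: card_insert_if)
  finally show ?thesis by (simp add: card_UNIV)
qed

text \<open>From \<open>n = 5\<close> on, the joint kernel has at least 8 elements. Taking
  \<open>c = 0\<close> supplies elements of the kernel of \<open>Tr\<close> alone.\<close>

lemma two_nonzero_in_common_kernel:
  assumes "c \<noteq> 1" "n \<ge> 5"
  obtains x y where "x \<noteq> 0" "y \<noteq> 0" "x \<noteq> y" "Tr x = 0" "Tr y = 0"
    "Tr (c * x) = 0" "Tr (c * y) = 0"
proof -
  let ?S = "{x. Tr x = 0 \<and> Tr (c * x) = 0}"
  have "(2 :: nat) ^ 5 \<le> 2 ^ n"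
    using assms(2) by (intro power_increasing) auto
  hence "2 < card ?S"
    using card_common_kernel[OF assms(1)] by simp
  hence "1 < card (?S - {0})"
    by (simp add: card_Diff_singleton_if)
  hence "\<exists>x\<in>?S - {0}. \<exists>y\<in>?S - {0}. x \<noteq> y"
    using card_le_Suc0_iff_eq[of "?S - {0}"] by (force simp: not_le)
  thus ?thesis using that by auto
qed

end

section \<open>The plane of a presemifield\<close>

lemma line_inf_simps [simp]:
  "Affine x y \<notin> line_inf" "Slope a \<in> line_inf" "Vertex \<in> line_inf"
  by (auto simp: line_inf_def)

lemma vertical_line_simps [simp]:
  "Affine x y \<in> vertical_line a \<longleftrightarrow> x = a" "Slope s \<notin> vertical_line a" "Vertex \<in> vertical_line a"
  by (auto simp: vertical_line_def)

lemma sloped_line_simps [simp]: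
  "Affine x y \<in> sloped_line m a b \<longleftrightarrow> y = m x a + b"
  "Slope s \<in> sloped_line m a b \<longleftrightarrow> s = a" "Vertex \<notin> sloped_line m a b"
  by (auto simp: sloped_line_def)

lemma plane_linesI [simp]:
  "line_inf \<in> plane_lines m" "vertical_line a \<in> plane_lines m" "sloped_line m a b \<in> plane_lines m"
  by (auto simp: plane_lines_def)

lemma plane_lines_cases:
  assumes "l \<in> plane_lines m"
  obtains "l = line_inf" | a where "l = vertical_line a" | a b where "l = sloped_line m a b"
  using assms by (auto simp: plane_lines_def)

lemma line_Slope_Affine:
  assumes "l \<in> plane_lines m" "Slope s \<in> l" "Affine x y \<in> l"
  obtains b where "l = sloped_line m s b"
  using assms(1) by (cases rule: plane_lines_cases) (use assms that in auto)

lemma line_Vertex_Affine: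
  assumes "l \<in> plane_lines m" "Vertex \<in> l" "Affine x y \<in> l"
  shows "l = vertical_line x"
  using assms(1) by (cases rule: plane_lines_cases) (use assms in auto)

lemma line_Vertex:
  assumes "l \<in> plane_lines m" "Vertex \<in> l"
  obtains "l = line_inf" | a where "l = vertical_line a"
  using assms(1) by (cases rule: plane_lines_cases) (use assms that in auto)

lemma finite_plane_lines: "finite (plane_lines m)"
proof -
  have "{sloped_line m a b | a b. True} = range (\<lambda>(a, b). sloped_line m a b)"
    by auto
  thus ?thesis by (simp add: plane_lines_def)
qed

text \<open>There are finitely many lines, so the injective map that \<open>f\<close> induces on
  them is automatically onto.\<close>

lemma collineationI:
  assumes "bij f" "\<And>l. l \<in> plane_lines m \<Longrightarrow> f ` l \<in> plane_lines m"
  shows "collineation m f"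
proof -
  have "inj_on ((`) f) (plane_lines m)"
    by (intro inj_onI) (use assms(1) in \<open>simp add: bij_is_inj inj_image_eq_iff\<close>)
  hence "(`) f ` plane_lines m = plane_lines m"
    using assms(2) by (intro endo_inj_surj finite_plane_lines) auto
  thus ?thesis using assms(1) by (simp add: collineation_def)
qed

lemma collineation_image_line:
  "collineation m f \<Longrightarrow> l \<in> plane_lines m \<Longrightarrow> f ` l \<in> plane_lines m"
  by (auto simp: collineation_def)

lemma collineation_line_preimage:
  assumes "collineation m f" "l \<in> plane_lines m"
  obtains k where "k \<in> plane_lines m" "l = f ` k"
  using assms by (metis collineation_def imageE)

lemma collineation_inj: "collineation m f \<Longrightarrow> f P = f Q \<longleftrightarrow> P = Q"
  by (auto simp: collineation_def bij_def inj_eq)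

lemma collineation_comp:
  assumes "collineation m f" "collineation m g"
  shows "collineation m (f \<circ> g)"
proof (rule collineationI)
  show "bij (f \<circ> g)"
    using assms by (simp add: collineation_def bij_comp)
  show "(f \<circ> g) ` l \<in> plane_lines m" if "l \<in> plane_lines m" for l
    unfolding image_comp[symmetric] using that assms by (intro collineation_image_line)
qed

lemma collineation_inv:
  assumes "collineation m f"
  shows "collineation m (inv_into UNIV f)"
proof (rule collineationI)
  have "bij f" using assms by (simp add: collineation_def)
  thus "bij (inv_into UNIV f)" by (rule bij_imp_bij_inv)
  fix l assume "l \<in> plane_lines m"
  then obtain k where "k \<in> plane_lines m" "l = f ` k"
    using collineation_line_preimage[OF assms] by blast
  thus "inv_into UNIV f ` l \<in> plane_lines m"
    using \<open>bij f\<close> by (simp add: bij_is_inj image_inv_f_f)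
qed

section \<open>Elations and transitive centres\<close>

definition elation ::
  "('a::{field,finite} \<Rightarrow> 'a \<Rightarrow> 'a) \<Rightarrow> 'a point set \<Rightarrow> 'a point \<Rightarrow> ('a point \<Rightarrow> 'a point) \<Rightarrow> bool" where
  "elation m l P \<phi> \<longleftrightarrow> collineation m \<phi> \<and> (\<forall>Q\<in>l. \<phi> Q = Q) \<and>
     (\<forall>k\<in>plane_lines m. P \<in> k \<longrightarrow> \<phi> ` k = k)"

text \<open>This is (P, l)-transitivity for every axis \<open>l\<close> through \<open>P\<close>,
  the dual of the condition defining a translation plane. That the centre lies on the axis is
  imposed here, not in \<open>elation\<close>.\<close>

definition transitive_centre ::
  "('a::{field,finite} \<Rightarrow> 'a \<Rightarrow> 'a) \<Rightarrow> 'a point \<Rightarrow> bool" where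
  "transitive_centre m P \<longleftrightarrow>
     (\<forall>l\<in>plane_lines m. \<forall>k\<in>plane_lines m. P \<in> l \<longrightarrow> P \<in> k \<longrightarrow> k \<noteq> l \<longrightarrow>
        (\<forall>Q\<in>k - {P}. \<forall>R\<in>k - {P}. \<exists>\<phi>. elation m l P \<phi> \<and> \<phi> Q = R))"

lemma transitive_centreD:
  assumes "transitive_centre m P" "l \<in> plane_lines m" "k \<in> plane_lines m"
    "P \<in> l" "P \<in> k" "k \<noteq> l" "Q \<in> k" "Q \<noteq> P" "R \<in> k" "R \<noteq> P"
  obtains \<phi> where "elation m l P \<phi>" "\<phi> Q = R"
  using assms unfolding transitive_centre_def by blast

lemma elation_conjugate:
  assumes f: "collineation m f" and \<phi>: "elation m l P \<phi>"
  shows "elation m (f ` l) (f P) (f \<circ> \<phi> \<circ> inv_into UNIV f)"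
proof -
  have inv_f: "inv_into UNIV f (f X) = X" for X
    using f by (simp add: collineation_def bij_is_inj)
  have "(f \<circ> \<phi> \<circ> inv_into UNIV f) ` k = k" if "k \<in> plane_lines m" "f P \<in> k" for k
  proof -
    obtain k' where k': "k' \<in> plane_lines m" "k = f ` k'"
      using collineation_line_preimage[OF f] \<open>k \<in> plane_lines m\<close> by metis
    moreover have "P \<in> k'"
      using that(2) k'(2) f by (auto simp: collineation_inj)
    ultimately have "\<phi> ` k' = k'"
      using \<phi> by (simp add: elation_def)
    moreover have "(f \<circ> \<phi> \<circ> inv_into UNIV f) ` k = f ` \<phi> ` k'"
      using k'(2) by (simp add: image_image inv_f)
    ultimately show ?thesis using k'(2) by simp
  qed
  moreover have "collineation m (f \<circ> \<phi> \<circ> inv_into UNIV f)"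
    using f \<phi> by (intro collineation_comp collineation_inv) (auto simp: elation_def)
  moreover have "(f \<circ> \<phi> \<circ> inv_into UNIV f) Q = Q" if "Q \<in> f ` l" for Q
    using that \<phi> by (auto simp: inv_f elation_def)
  ultimately show ?thesis by (simp add: elation_def)
qed

text \<open>Conjugation by \<open>f\<close> carries elations to elations, so the property is a
  collineation invariant; this is what separates the two hyperovals.\<close>

lemma transitive_centre_image:
  assumes f: "collineation m f" and P: "transitive_centre m P"
  shows "transitive_centre m (f P)"
  unfolding transitive_centre_def
proof (intro ballI impI)
  fix l k Q R
  assume "l \<in> plane_lines m" "k \<in> plane_lines m" "f P \<in> l" "f P \<in> k" "k \<noteq> l"
    "Q \<in> k - {f P}" "R \<in> k - {f P}"
  moreover obtain l' k' where l'k': "l' \<in> plane_lines m" "k' \<in> plane_lines m" "l = f ` l'" "k = f ` k'"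
    using collineation_line_preimage[OF f] calculation(1,2) by metis
  moreover obtain Q' R' where Q'R': "Q' \<in> k'" "R' \<in> k'" "Q = f Q'" "R = f R'"
    using calculation by auto
  ultimately have "P \<in> l'" "P \<in> k'" "k' \<noteq> l'" "Q' \<noteq> P" "R' \<noteq> P"
    using f by (auto simp: collineation_inj)
  then obtain \<phi> where \<phi>: "elation m l' P \<phi>" "\<phi> Q' = R'"
    using transitive_centreD[OF P] l'k' Q'R' by metis
  have "inv_into UNIV f (f Q') = Q'"
    using f by (simp add: collineation_def bij_is_inj)
  hence "(f \<circ> \<phi> \<circ> inv_into UNIV f) Q = R"
    using \<phi>(2) Q'R' by simp
  thus "\<exists>\<phi>. elation m l (f P) \<phi> \<and> \<phi> Q = R"
    using elation_conjugate[OF f \<phi>(1)] l'k'(3) by blast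
qed

section \<open>Translations and shears\<close>

fun shear ::
  "('a::{field,finite} \<Rightarrow> 'a \<Rightarrow> 'a) \<Rightarrow> 'a \<Rightarrow> 'a \<Rightarrow> 'a point \<Rightarrow> 'a point" where
  "shear m a t (Affine x y) = Affine x (y + m (x - a) t)"
| "shear m a t (Slope s) = Slope (s + t)"
| "shear m a t Vertex = Vertex"

lemma image_eqI_of_mem_iff:
  assumes "bij f" "\<And>P. f P \<in> B \<longleftrightarrow> P \<in> A"
  shows "f ` A = B"
  using assms by (metis bij_is_surj image_subset_iff subsetI subset_antisym surj_def rev_image_eqI)

lemma bij_plane_translation: "bij (plane_translation a b)"
proof (rule o_bij)
  show "plane_translation (-a) (-b) \<circ> plane_translation a b = id"
    and "plane_translation a b \<circ> plane_translation (-a) (-b) = id"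
    by (rule ext, rename_tac P, case_tac P; simp)+
qed

lemma group_translation_group: "group (translation_group :: ('a::{field,finite} point \<Rightarrow> _) monoid)"
proof (rule groupI)
  let ?G = "translation_group :: ('a point \<Rightarrow> 'a point) monoid"
  have comp: "plane_translation a b \<circ> plane_translation c d = plane_translation (a + c) (b + d)"
    for a b c d :: 'a
    by (rule ext, rename_tac P, case_tac P) (simp_all add: ac_simps)
  have id: "plane_translation 0 0 = (id :: 'a point \<Rightarrow> _)"
    by (rule ext, rename_tac P, case_tac P) simp_all
  show "f \<otimes>\<^bsub>?G\<^esub> g \<in> carrier ?G" if "f \<in> carrier ?G" "g \<in> carrier ?G" for f g
    using that by (auto simp: translation_group_def comp) blast
  show "\<one>\<^bsub>?G\<^esub> \<in> carrier ?G"
    using id by (auto simp: translation_group_def intro: sym)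
  show "f \<otimes>\<^bsub>?G\<^esub> g \<otimes>\<^bsub>?G\<^esub> h = f \<otimes>\<^bsub>?G\<^esub> (g \<otimes>\<^bsub>?G\<^esub> h)" for f g h
    by (simp add: translation_group_def comp_assoc)
  show "\<one>\<^bsub>?G\<^esub> \<otimes>\<^bsub>?G\<^esub> f = f" for f
    by (simp add: translation_group_def)
  show "\<exists>g\<in>carrier ?G. g \<otimes>\<^bsub>?G\<^esub> f = \<one>\<^bsub>?G\<^esub>" if f: "f \<in> carrier ?G" for f
  proof -
    obtain a b where "f = plane_translation a b"
      using f by (auto simp: translation_group_def)
    hence "plane_translation (-a) (-b) \<circ> f = id"
      by (simp add: comp id)
    thus ?thesis
      by (intro bexI[of _ "plane_translation (-a) (-b)"]) (auto simp: translation_group_def)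
  qed
qed

locale presemifield =
  fixes m :: "'a::{field,finite} \<Rightarrow> 'a \<Rightarrow> 'a"
  assumes add_right: "m x (y + z) = m x y + m x z"
    and add_left: "m (x + y) z = m x z + m y z"
    and eq_0_imp: "m x y = 0 \<Longrightarrow> x = 0 \<or> y = 0"
begin

lemma zero_left [simp]: "m 0 y = 0"
  by (metis add_left add.right_neutral add_left_cancel)

lemma zero_right [simp]: "m x 0 = 0"
  by (metis add_right add.right_neutral add_left_cancel)

lemma minus_right: "m x (-y) = - m x y"
  using add_right[of x y "-y"] by (simp add: eq_neg_iff_add_eq_0 add.commute)

lemma diff_left: "m (x - y) z = m x z - m y z"
  using add_left[of "x - y" y z] by simp

lemma diff_right: "m x (y - z) = m x y - m x z"
  using add_right[of x "y - z" z] by simp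

lemma cancel_right: "z \<noteq> 0 \<Longrightarrow> m x z = m y z \<Longrightarrow> x = y"
  using eq_0_imp[of "x - y" z] by (simp add: diff_left)

lemma solve_right:
  assumes "c \<noteq> 0"
  obtains t where "m c t = y"
proof -
  have "inj (m c)"
    using eq_0_imp[of c] assms by (intro injI) (metis diff_right eq_iff_diff_eq_0)
  hence "surj (m c)"
    by (simp add: finite_UNIV_inj_surj)
  thus ?thesis using that by (metis surjD)
qed

lemma image_translation:
  "plane_translation a b ` line_inf = line_inf"
  "plane_translation a b ` vertical_line c = vertical_line (c + a)"
  "plane_translation a b ` sloped_line m s c = sloped_line m s (c + b - m a s)"
  by (rule image_eqI_of_mem_iff[OF bij_plane_translation],
      rename_tac P, case_tac P; force simp: add_left algebra_simps)+

lemma collineation_translation: "collineation m (plane_translation a b)"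
  by (rule collineationI[OF bij_plane_translation], erule plane_lines_cases)
    (simp_all add: image_translation)

lemma bij_shear: "bij (shear m a t)"
proof (rule o_bij)
  show "shear m a (-t) \<circ> shear m a t = id" and "shear m a t \<circ> shear m a (-t) = id"
    by (rule ext, rename_tac P, case_tac P; simp add: minus_right)+
qed

text \<open>Additivity in the second argument merges \<open>m x s\<close> and \<open>m x t\<close>
  into a single term of slope \<open>s + t\<close>; the abscissa \<open>a\<close> of the axis
  affects only the intercept.\<close>

lemma image_shear:
  "shear m a t ` line_inf = line_inf"
  "shear m a t ` vertical_line c = vertical_line c"
  "shear m a t ` sloped_line m s c = sloped_line m (s + t) (c - m a t)"
  by (rule image_eqI_of_mem_iff[OF bij_shear],
      rename_tac P, case_tac P; force simp: add_right diff_left algebra_simps)+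

lemma collineation_shear: "collineation m (shear m a t)"
  by (rule collineationI[OF bij_shear], erule plane_lines_cases) (simp_all add: image_shear)

lemma elation_translation: "elation m line_inf Vertex (plane_translation 0 b)"
proof -
  have "plane_translation 0 b ` k = k" if "k \<in> plane_lines m" "Vertex \<in> k" for k
    using that by (cases rule: line_Vertex) (simp_all only: image_translation add_0_right)
  moreover have "plane_translation 0 b Q = Q" if "Q \<in> line_inf" for Q
    using that by (cases Q) simp_all
  ultimately show ?thesis
    by (simp add: elation_def collineation_translation)
qed

lemma elation_shear: "elation m (vertical_line a) Vertex (shear m a t)"
proof -
  have "shear m a t ` k = k" if "k \<in> plane_lines m" "Vertex \<in> k" for k
    using that by (cases rule: line_Vertex) (simp_all only: image_shear)
  moreover have "shear m a t Q = Q" if "Q \<in> vertical_line a" for Q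
    using that by (cases Q) simp_all
  ultimately show ?thesis
    by (simp add: elation_def collineation_shear)
qed

text \<open>Translations in the \<open>y\<close> direction serve the axis \<open>line_inf\<close>,
  shears serve the affine axes. On another vertical line transitivity amounts to solving
  \<open>m (c - a) t = z - y\<close>.\<close>

lemma transitive_centre_Vertex: "transitive_centre m Vertex"
  unfolding transitive_centre_def
proof (intro ballI impI)
  fix l k :: "'a point set" and Q R
  assume l: "l \<in> plane_lines m" "Vertex \<in> l" and k: "k \<in> plane_lines m" "Vertex \<in> k"
    and "k \<noteq> l" and QR: "Q \<in> k - {Vertex}" "R \<in> k - {Vertex}"
  from l show "\<exists>\<phi>. elation m l Vertex \<phi> \<and> \<phi> Q = R"
  proof (cases rule: line_Vertex)
    case 1
    then obtain c where "k = vertical_line c"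
      using line_Vertex[OF k] \<open>k \<noteq> l\<close> by metis
    then obtain y z where "Q = Affine c y" "R = Affine c z"
      using QR by (auto simp: vertical_line_def)
    hence "plane_translation 0 (z - y) Q = R" by simp
    thus ?thesis using 1 elation_translation by blast
  next
    case (2 a)
    from k have "\<exists>t. shear m a t Q = R"
    proof (cases rule: line_Vertex)
      case 1
      then obtain s s' where "Q = Slope s" "R = Slope s'"
        using QR by (auto simp: line_inf_def)
      hence "shear m a (s' - s) Q = R" by simp
      thus ?thesis ..
    next
      case (2 c)
      then obtain y z where "Q = Affine c y" "R = Affine c z"
        using QR by (auto simp: vertical_line_def)
      moreover obtain t where "m (c - a) t = z - y"
        using 2 \<open>k \<noteq> l\<close> \<open>l = vertical_line a\<close> by (metis eq_iff_diff_eq_0 solve_right)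
      ultimately have "shear m a t Q = R" by simp
      thus ?thesis ..
    qed
    thus ?thesis using 2 elation_shear by blast
  qed
qed

text \<open>Translations spread the property from one affine point to all. The elation with centre
  the origin and axis \<open>x = 0\<close> then moves \<open>Affine 1 0\<close> along
  \<open>y = 0\<close> to \<open>Slope 0\<close>. A point \<open>Slope s\<close> is brought there by
  a shear.\<close>

lemma transitive_centre_Slope_0:
  assumes "transitive_centre m P" "P \<noteq> Vertex"
  shows "transitive_centre m (Slope 0)"
proof (cases P)
  case (Affine x y)
  have tc: "transitive_centre m (Affine u v)" for u v
    using transitive_centre_image[OF collineation_translation[of "u - x" "v - y"] assms(1)] Affine
    by simp
  have "vertical_line 0 \<noteq> sloped_line m 0 0"
    using vertical_line_simps(3) sloped_line_simps(3) by metis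
  then obtain \<phi> where "elation m (vertical_line 0) (Affine 0 0) \<phi>" "\<phi> (Affine 1 0) = Slope 0"
    by (auto intro: transitive_centreD[OF tc[of 0 0], of "vertical_line 0" "sloped_line m 0 0"
          "Affine 1 0" "Slope 0"])
  thus ?thesis
    using transitive_centre_image[OF _ tc[of 1 0]] by (metis elation_def)
next
  case (Slope s)
  thus ?thesis
    using transitive_centre_image[OF collineation_shear[of 0 "-s"] assms(1)] by simp
qed (use assms in simp)

text \<open>The elation taking \<open>Vertex\<close> to \<open>Slope s\<close> maps the line
  \<open>y = m x a\<close> to a line through the origin of some slope \<open>b\<close>. The premise
  says that \<open>u\<close> is the new abscissa of \<open>Affine x (m x a)\<close>, the conclusion
  that the image point lies on the image line.\<close>

lemma transitive_centre_Slope_0_identity: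
  assumes tc: "transitive_centre m (Slope 0)" and s: "s \<noteq> 0" "a + s \<noteq> 0"
  obtains b where "\<And>x u. m u s = m x s + m x a \<Longrightarrow> m u b = m x a"
proof -
  have "line_inf \<noteq> sloped_line m 0 0"
    using line_inf_simps(3) sloped_line_simps(3) by metis
  then obtain \<phi> where \<phi>: "elation m (sloped_line m 0 0) (Slope 0) \<phi>" "\<phi> Vertex = Slope s"
    using s(1) by (auto intro: transitive_centreD[OF tc, of "sloped_line m 0 0" line_inf
          Vertex "Slope s"])
  have col: "collineation m \<phi>" and Slope_0: "\<phi> (Slope 0) = Slope 0"
    using \<phi>(1) by (auto simp: elation_def)
  have axis: "\<phi> (Affine x 0) = Affine x 0" for x
    using \<phi>(1) by (auto simp: elation_def)
  have centre: "\<phi> ` k = k" if "k \<in> plane_lines m" "Slope 0 \<in> k" for k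
    using \<phi>(1) that by (auto simp: elation_def)
  \<comment> \<open>Horizontal lines pass through the centre, so \<open>y\<close> is kept. The image
    of a vertical line joins its fixed point \<open>Affine x 0\<close> to \<open>Slope s\<close>,
    which determines \<open>u\<close>.\<close>
  have aff: "\<exists>u. \<phi> (Affine x y) = Affine u y \<and> m u s = y + m x s" for x y
  proof -
    have "\<phi> (Affine x y) \<in> sloped_line m 0 y"
      using centre[of "sloped_line m 0 y"] by force
    moreover have "\<phi> (Affine x y) \<noteq> Slope 0"
      using collineation_inj[OF col, of "Affine x y" "Slope 0"] Slope_0 by simp
    ultimately obtain u where u: "\<phi> (Affine x y) = Affine u y"
      by (auto simp: sloped_line_def)
    let ?l = "\<phi> ` vertical_line x"
    have "?l \<in> plane_lines m"
      using col by (simp add: collineation_image_line)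
    moreover have l: "Slope s \<in> ?l" "Affine x 0 \<in> ?l" "Affine u y \<in> ?l"
      using \<phi>(2) axis[of x] u vertical_line_simps by (metis imageI)+
    ultimately obtain b where "?l = sloped_line m s b"
      using line_Slope_Affine by metis
    hence "0 = m x s + b" "y = m u s + b"
      using l by auto
    thus ?thesis using u by (auto simp: algebra_simps eq_neg_iff_add_eq_0)
  qed
  let ?l = "\<phi> ` sloped_line m a 0"
  have l: "?l \<in> plane_lines m"
    using col by (simp add: collineation_image_line)
  have l_pts: "\<phi> (Slope a) \<in> ?l" "Affine 0 0 \<in> ?l" "\<phi> (Affine x (m x a)) \<in> ?l" for x
  proof -
    show "Affine 0 0 \<in> ?l"
      using axis[of 0] by (intro image_eqI[of _ _ "Affine 0 0"]) auto
  qed auto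
  have "\<phi> (Slope a) \<in> line_inf"
    using centre[of line_inf] by force
  \<comment> \<open>Otherwise the image line is \<open>x = 0\<close>, so the point over
    \<open>x = 1\<close> moves to abscissa 0; this contradicts \<open>a + s\<close> being
    nonzero.\<close>
  moreover have "\<phi> (Slope a) \<noteq> Vertex"
  proof
    assume "\<phi> (Slope a) = Vertex"
    hence eq: "?l = vertical_line 0"
      using l l_pts line_Vertex_Affine by metis
    obtain u where "\<phi> (Affine 1 (m 1 a)) = Affine u (m 1 a)" "m u s = m 1 a + m 1 s"
      using aff[of 1 "m 1 a"] by blast
    moreover from this have "u = 0"
      using l_pts(3)[of 1] eq by simp
    ultimately have "m 1 (a + s) = 0"
      by (simp add: add_right)
    thus False using eq_0_imp s(2) by fastforce
  qed
  ultimately obtain b where b: "\<phi> (Slope a) = Slope b"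
    by (auto simp: line_inf_def)
  then obtain c where c: "?l = sloped_line m b c"
    using l l_pts line_Slope_Affine by metis
  have "m u b = m x a" if "m u s = m x s + m x a" for x u
  proof -
    obtain v where v: "\<phi> (Affine x (m x a)) = Affine v (m x a)" "m v s = m x a + m x s"
      using aff[of x "m x a"] by blast
    hence "v = u"
      using that v(2) cancel_right[OF s(1)] by (simp add: add.commute)
    thus ?thesis
      using l_pts(2) l_pts(3)[of x] v(1) c by simp
  qed
  thus ?thesis by (rule that)
qed

end

section \<open>Knuth's presemifield\<close>

context odd_binary_field
begin

abbreviation knuth :: "'a \<Rightarrow> 'a \<Rightarrow> 'a" where "knuth \<equiv> knuth_mult n"

lemma knuth_Tr_0_left: "Tr x = 0 \<Longrightarrow> knuth x y = x * y + x\<^sup>2 * Tr y"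
  by (simp add: knuth_mult_def power_mult_distrib power2_Tr)

lemma knuth_Tr_0_right: "Tr y = 0 \<Longrightarrow> knuth x y = x * y + y\<^sup>2 * Tr x"
  by (simp add: knuth_mult_def power_mult_distrib power2_Tr)

text \<open>For a zero product of nonzero factors, different traces would force
  \<open>x = y\<close>. If both traces are 1, then \<open>w = x / y\<close> satisfies
  \<open>w + (1 + w^2) = 0\<close>, although the left side has trace
  \<open>Tr 1 = 1\<close>.\<close>

lemma presemifield_knuth: "presemifield knuth"
proof
  show "knuth x (y + z) = knuth x y + knuth x z" for x y z
    by (simp add: knuth_mult_def Tr_add add_power2 algebra_simps)
  show "knuth (x + y) z = knuth x z + knuth y z" for x y z
    by (simp add: knuth_mult_def Tr_add add_power2 algebra_simps)
next
  fix x y assume eq: "knuth x y = 0"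
  show "x = 0 \<or> y = 0"
  proof (rule ccontr)
    assume nz: "\<not> (x = 0 \<or> y = 0)"
    consider "Tr x = 0" "Tr y = 0" | "Tr x = 0" "Tr y = 1" | "Tr x = 1" "Tr y = 0"
      | "Tr x = 1" "Tr y = 1"
      using Tr_cases[of x] Tr_cases[of y] by blast
    thus False
    proof cases
      case 1
      thus False using eq nz by (simp add: knuth_Tr_0_left)
    next
      case 2
      hence "x * (y + x) = 0"
        using eq by (simp add: knuth_Tr_0_left power2_eq_square distrib_left)
      hence "y = x" using nz by (simp add: add_eq_0_iff_eq)
      thus False using 2 by simp
    next
      case 3
      hence "y * (x + y) = 0"
        using eq by (simp add: knuth_Tr_0_right power2_eq_square distrib_left mult.commute)
      hence "x = y" using nz by (simp add: add_eq_0_iff_eq)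
      thus False using 3 by simp
    next
      case 4
      hence "x * y + (y\<^sup>2 + x\<^sup>2) = 0"
        using eq by (simp add: knuth_mult_def add_power2)
      hence "(x * y + (y\<^sup>2 + x\<^sup>2)) / y\<^sup>2 = 0"
        by simp
      hence "x / y + (1 + (x / y)\<^sup>2) = 0"
        using nz by (simp add: add_divide_distrib power_divide power2_eq_square)
      hence "Tr (x / y + (1 + (x / y)\<^sup>2)) = 0"
        by simp
      thus False by (simp only: Tr_add Tr_power2 Tr_1) (simp add: add.left_commute)
    qed
  qed
qed

sublocale knuth: presemifield knuth
  by (rule presemifield_knuth)

section \<open>Intersections of \<open>O_g\<close> with lines\<close>

lemma knuth_g_left: "knuth (d\<^sup>2 + d) a = (d\<^sup>2 + d) * a + (d\<^sup>2 + d)\<^sup>2 * Tr a"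
  by (rule knuth_Tr_0_left) (simp add: Tr_add)

text \<open>In terms of \<open>z = d + 1\<close> the cubic reads
  \<open>1 = z * (a + (z^2 + z))\<close>, and \<open>z^2 + z\<close> has trace 0.\<close>

lemma cubic_inverse_trace:
  assumes "1 = (d + 1) * a + d * (d + 1)\<^sup>2"
  shows "d + 1 \<noteq> 0" "Tr (inverse (d + 1)) = Tr a"
proof -
  define z where "z = d + 1"
  have d: "d = z + 1"
    by (simp add: z_def ac_simps)
  have eq: "1 = z * (a + (z\<^sup>2 + z))"
    using assms unfolding d by (simp add: algebra_simps power2_eq_square)
  show "d + 1 \<noteq> 0"
    using eq unfolding z_def[symmetric] by auto
  have "inverse z = a + (z\<^sup>2 + z)"
    using eq by (metis inverse_unique)
  hence "Tr (inverse z) = Tr a"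
    by (simp add: Tr_add)
  thus "Tr (inverse (d + 1)) = Tr a"
    by (simp add: z_def)
qed

lemma secant_difference_unique:
  assumes "d \<noteq> 0" "d = knuth (d\<^sup>2 + d) a" "e \<noteq> 0" "e = knuth (e\<^sup>2 + e) a"
  shows "d = e"
proof (cases "Tr a = 0")
  case True
  have *: "(x + 1) * a = 1" if "x \<noteq> 0" "x = knuth (x\<^sup>2 + x) a" for x
  proof -
    have "x * 1 = (x\<^sup>2 + x) * a"
      using that(2) True by (simp add: knuth_g_left)
    also have "\<dots> = x * ((x + 1) * a)"
      by (simp add: algebra_simps power2_eq_square)
    finally show ?thesis using that(1) by (metis mult_left_cancel)
  qed
  have "(d + 1) * a = (e + 1) * a"
    using *[of d] *[of e] assms by simp
  moreover have "a \<noteq> 0"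
    using *[of d] assms by auto
  ultimately show ?thesis by simp
next
  case False
  hence Tr_a: "Tr a = 1"
    using Tr_cases[of a] by simp
  have *: "1 = (x + 1) * a + x * (x + 1)\<^sup>2" if "x \<noteq> 0" "x = knuth (x\<^sup>2 + x) a" for x
  proof -
    have "x * 1 = (x\<^sup>2 + x) * a + (x\<^sup>2 + x)\<^sup>2"
      using that(2) by (simp add: knuth_g_left Tr_a)
    also have "\<dots> = x * ((x + 1) * a + x * (x + 1)\<^sup>2)"
      by (simp add: algebra_simps power2_eq_square)
    finally show ?thesis using that(1) by (metis mult_left_cancel)
  qed
  have cubic: "x ^ 3 + ((a + 1) * x + (a + 1)) = 0" if "1 = (x + 1) * a + x * (x + 1)\<^sup>2" for x
  proof -
    have "x ^ 3 + ((a + 1) * x + (a + 1)) = (x + 1) * a + x * (x + 1)\<^sup>2 + 1"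
      by (simp add: algebra_simps power2_eq_square power3_eq_cube two_eq_0)
    thus ?thesis by (simp flip: that)
  qed
  note d = *[OF assms(1,2)] and e = *[OF assms(3,4)]
  show ?thesis
  proof (rule ccontr)
    assume "d \<noteq> e"
    define z where "z = d + 1"
    have z: "z \<noteq> 0" "Tr (inverse z) = 1"
      using cubic_inverse_trace[OF d] Tr_a by (simp_all add: z_def)
    \<comment> \<open>Adding the cubic equations of the two roots and cancelling
      \<open>d + e\<close> expresses \<open>a + 1\<close> through \<open>d\<close> and
      \<open>e\<close>.\<close>
    have "(d + e) * (d\<^sup>2 + (d * e + (e\<^sup>2 + (a + 1)))) =
        (d ^ 3 + ((a + 1) * d + (a + 1))) + (e ^ 3 + ((a + 1) * e + (a + 1)))"
      by (simp add: algebra_simps power2_eq_square power3_eq_cube two_eq_0)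
    also have "\<dots> = 0"
      by (simp only: cubic[OF d] cubic[OF e] add_0)
    finally have "d\<^sup>2 + (d * e + (e\<^sup>2 + (a + 1))) = 0"
      using \<open>d \<noteq> e\<close> by (simp add: add_eq_0_iff_eq)
    hence c: "a + 1 = d\<^sup>2 + (d * e + e\<^sup>2)"
      by (metis add.assoc add_eq_0_iff_eq)
    \<comment> \<open>The cubic at \<open>d\<close> gives a second expression for
      \<open>a + 1\<close>; equating the two and dividing by \<open>d^2\<close> leaves an
      Artin-Schreier equation for \<open>e / d\<close>.\<close>
    have "d ^ 3 + (a + 1) * z = 0"
      using cubic[OF d] by (simp add: z_def algebra_simps)
    hence "(a + 1) * z = d\<^sup>2 * (z + 1)"
      by (simp add: add_eq_0_iff_eq z_def power2_eq_square power3_eq_cube ac_simps)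
    hence "(a + 1) / d\<^sup>2 = (z + 1) / z"
      using assms(1) z(1) by (simp add: frac_eq_eq mult.commute)
    hence "(d\<^sup>2 + (d * e + e\<^sup>2)) / d\<^sup>2 = 1 + inverse z"
      using z(1) by (simp add: c add_divide_distrib inverse_eq_divide)
    moreover have "(d\<^sup>2 + (d * e + e\<^sup>2)) / d\<^sup>2 = 1 + (e / d + (e / d)\<^sup>2)"
      using assms(1) by (simp add: add_divide_distrib power_divide power2_eq_square)
    ultimately have "inverse z = e / d + (e / d)\<^sup>2"
      by simp
    hence "Tr (inverse z) = 0"
      by (simp add: Tr_add)
    thus False using z(2) by simp
  qed
qed

lemma subset_pair_of_differences:
  fixes Y :: "'a set"
  assumes "\<And>y y'. y \<in> Y \<Longrightarrow> y' \<in> Y \<Longrightarrow> y \<noteq> y' \<Longrightarrow> y + y' = d"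
  obtains u v where "Y \<subseteq> {u, v}"
proof (cases "Y = {}")
  case False
  then obtain u where "u \<in> Y" by blast
  have "y \<in> {u, u + d}" if "y \<in> Y" for y
    using assms[OF \<open>u \<in> Y\<close> that] by (cases "u = y") auto
  thus ?thesis using that[of u "u + d"] by blast
qed (use that in blast)

text \<open>On a vertical line the parameters are roots of a quadratic and differ by 1. On a line of
  slope 0 or 1 the point at infinity already belongs to \<open>O_g\<close>, so at most one affine
  point is allowed; for other slopes two are.\<close>

lemma O_g_line_subset_pair:
  assumes "l \<in> plane_lines knuth"
  obtains P Q where "O_g \<inter> l \<subseteq> {P, Q :: 'a point}"
  using assms
proof (cases rule: plane_lines_cases)
  case 1
  hence "O_g \<inter> l \<subseteq> {Slope 0, Slope 1}"
    by (auto simp: O_g_def)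
  thus ?thesis by (rule that)
next
  case (2 a)
  let ?Y = "{y. y\<^sup>2 + y = a}"
  have "y + y' = 1" if "y \<in> ?Y" "y' \<in> ?Y" "y \<noteq> y'" for y y'
  proof -
    have "(y + y') * (y + y' + 1) = (y\<^sup>2 + y) + (y'\<^sup>2 + y')"
      by (simp add: algebra_simps power2_eq_square two_eq_0)
    also have "\<dots> = 0" using that by simp
    finally show ?thesis using that(3) by (simp add: add_eq_0_iff_eq)
  qed
  then obtain u v where "?Y \<subseteq> {u, v}"
    by (rule subset_pair_of_differences)
  moreover have "O_g \<inter> l \<subseteq> (\<lambda>y. Affine (y\<^sup>2 + y) y) ` ?Y"
    using 2 by (auto simp: O_g_def)
  ultimately have "O_g \<inter> l \<subseteq> {Affine (u\<^sup>2 + u) u, Affine (v\<^sup>2 + v) v}"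
    by blast
  thus ?thesis by (rule that)
next
  case (3 a b)
  let ?Y = "{y. y = knuth (y\<^sup>2 + y) a + b}"
  let ?f = "\<lambda>y. Affine (y\<^sup>2 + y) y"
  have diff: "y + y' = knuth ((y + y')\<^sup>2 + (y + y')) a" if "y \<in> ?Y" "y' \<in> ?Y" for y y'
  proof -
    have "(y + y')\<^sup>2 + (y + y') = (y\<^sup>2 + y) + (y'\<^sup>2 + y')"
      by (simp add: add_power2 ac_simps)
    hence "knuth ((y + y')\<^sup>2 + (y + y')) a + (b + b) =
        (knuth (y\<^sup>2 + y) a + b) + (knuth (y'\<^sup>2 + y') a + b)"
      by (simp only: knuth.add_left ac_simps)
    moreover have "knuth (y\<^sup>2 + y) a + b = y" "knuth (y'\<^sup>2 + y') a + b = y'"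
      using that by simp_all
    ultimately show ?thesis by (simp only: add_self add_0_right)
  qed
  have sub: "O_g \<inter> l \<subseteq> ?f ` ?Y \<union> ({Slope 0, Slope 1} \<inter> {Slope a})"
    using 3 by (auto simp: O_g_def)
  show ?thesis
  proof (cases "a = 0 \<or> a = 1")
    case True
    have zero: "d = 0" if "d = knuth (d\<^sup>2 + d) a" for d
    proof (cases "a = 0")
      case False
      \<comment> \<open>For \<open>a = 1\<close> the equation is \<open>d = g d + (g d)^2\<close>,
        where the two copies of \<open>d^2\<close> cancel.\<close>
      hence "d = d ^ 4 + d"
        using that True
        by (simp add: knuth_g_left add_power2 add.left_commute two_eq_0 flip: power_mult)
      thus ?thesis by simp
    qed (use that in simp)
    have "y = y'" if "y \<in> ?Y" "y' \<in> ?Y" for y y'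
      using zero[OF diff[OF that]] by (simp only: add_eq_0_iff_eq)
    then obtain u where "?Y \<subseteq> {u}"
      by blast
    hence "O_g \<inter> l \<subseteq> {Slope a, ?f u}"
      using sub by blast
    thus ?thesis by (rule that)
  next
    case False
    \<comment> \<open>If there is no nonzero solution, any \<open>d\<close> serves.\<close>
    obtain d where d: "\<And>e. e \<noteq> 0 \<Longrightarrow> e = knuth (e\<^sup>2 + e) a \<Longrightarrow> e = d"
      using secant_difference_unique by metis
    have "y + y' = d" if "y \<in> ?Y" "y' \<in> ?Y" "y \<noteq> y'" for y y'
      using d[OF _ diff[OF that(1,2)]] that(3) by (simp add: add_eq_0_iff_eq)
    then obtain u v where "?Y \<subseteq> {u, v}"
      by (rule subset_pair_of_differences)
    hence "O_g \<inter> l \<subseteq> {?f u, ?f v}"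
      using sub False by blast
    thus ?thesis by (rule that)
  qed
qed

section \<open>The translation group of \<open>O_g\<close>\<close>

lemma O_g_Diff_line_inf: "O_g - line_inf = range (\<lambda>y :: 'a. Affine (y\<^sup>2 + y) y)"
  by (auto simp: O_g_def)

lemma O_g_Int_line_inf: "O_g \<inter> line_inf = {Slope 0, Slope 1 :: 'a point}"
  by (auto simp: O_g_def)

lemma card_O_g: "card (O_g :: 'a point set) = CARD('a) + 2"
proof -
  have "finite (O_g :: 'a point set)"
    by (simp add: O_g_def full_SetCompr_eq)
  hence "card (O_g :: 'a point set) =
      card (O_g \<inter> line_inf :: 'a point set) + card (O_g - line_inf :: 'a point set)"
    by (rule card_Int_Diff)
  moreover have "card (O_g - line_inf :: 'a point set) = CARD('a)"
    unfolding O_g_Diff_line_inf by (intro card_image injI) simp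
  ultimately show ?thesis
    by (simp add: O_g_Int_line_inf)
qed

lemma hyperoval_O_g: "hyperoval knuth (O_g :: 'a point set)"
  unfolding hyperoval_def
proof (intro conjI ballI impI notI card_O_g)
  fix P Q R :: "'a point"
  assume *: "P \<in> O_g" "Q \<in> O_g" "R \<in> O_g" "P \<noteq> Q" "P \<noteq> R" "Q \<noteq> R"
    and "\<exists>l\<in>plane_lines knuth. P \<in> l \<and> Q \<in> l \<and> R \<in> l"
  then obtain l where l: "l \<in> plane_lines knuth" "P \<in> l" "Q \<in> l" "R \<in> l"
    by blast
  obtain X Y where "O_g \<inter> l \<subseteq> {X, Y}"
    using O_g_line_subset_pair[OF l(1)] by blast
  thus False using * l by blast
qed

text \<open>Since \<open>g\<close> is additive, the translations by \<open>(g d, d)\<close> form a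
  group isomorphic to the additive group of the field, acting on the affine points by shifting the
  parameter.\<close>

lemma translation_hyperoval_O_g: "translation_hyperoval knuth (O_g :: 'a point set)"
proof -
  let ?t = "\<lambda>d :: 'a. plane_translation (d\<^sup>2 + d) d"
  let ?p = "\<lambda>y :: 'a. Affine (y\<^sup>2 + y) y"
  have comp: "?t d \<circ> ?t e = ?t (d + e)" for d e
    by (rule ext, rename_tac P, case_tac P) (simp_all add: add_power2 ac_simps)
  have id: "?t 0 = id"
    by (rule ext, rename_tac P, case_tac P) simp_all
  have act: "?t d (?p y) = ?p (y + d)" for d y
    by (simp add: add_power2 ac_simps)
  have "subgroup (range ?t) translation_group"
  proof (rule group.subgroupI[OF group_translation_group])
    show "range ?t \<subseteq> carrier translation_group" "range ?t \<noteq> {}"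
      by (auto simp: translation_group_def)
    show "f \<otimes>\<^bsub>translation_group\<^esub> g \<in> range ?t" if "f \<in> range ?t" "g \<in> range ?t" for f g
      using that comp by (auto simp: translation_group_def)
    show "inv\<^bsub>translation_group\<^esub> f \<in> range ?t" if f: "f \<in> range ?t" for f
    proof -
      obtain d where d: "f = ?t d" using f by blast
      have "f \<otimes>\<^bsub>translation_group\<^esub> f = \<one>\<^bsub>translation_group\<^esub>"
        using comp[of d d] id d by (simp add: translation_group_def)
      moreover have "f \<in> carrier translation_group"
        using d by (auto simp: translation_group_def)
      ultimately have "inv\<^bsub>translation_group\<^esub> f = f"
        using group.inv_equality[OF group_translation_group] by blast
      thus ?thesis using f by simp
    qed
  qed
  moreover have inj: "inj ?t"
  proof (rule injI)
    fix d e :: 'a assume "?t d = ?t e"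
    hence "?t d (Affine 0 0) = ?t e (Affine 0 0)" by simp
    thus "d = e" by simp
  qed
  hence "card (range ?t) = CARD('a)"
    by (rule card_image)
  moreover have "acts_regularly_on (range ?t) (O_g - line_inf)"
    unfolding acts_regularly_on_def O_g_Diff_line_inf
  proof (intro conjI ballI)
    fix f assume "f \<in> range ?t"
    then obtain d where d: "f = ?t d" by blast
    have "f ` range ?p = ?p ` range (\<lambda>y. y + d)"
      unfolding d image_image act ..
    thus "f ` range ?p = range ?p"
      by simp
  next
    fix P Q assume "P \<in> range ?p" "Q \<in> range ?p"
    then obtain y z where yz: "P = ?p y" "Q = ?p z" by blast
    have iff: "?t d P = Q \<longleftrightarrow> d = y + z" for d
      unfolding yz act by (auto simp: add.left_commute)
    show "\<exists>!f. f \<in> range ?t \<and> f P = Q"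
    proof (rule ex1I[of _ "?t (y + z)"])
      show "?t (y + z) \<in> range ?t \<and> ?t (y + z) P = Q"
        using iff by blast
      fix f assume "f \<in> range ?t \<and> f P = Q"
      then obtain d where "f = ?t d" "?t d P = Q"
        by blast
      thus "f = ?t (y + z)"
        by (simp only: iff)
    qed
  qed
  moreover have "card (O_g \<inter> line_inf :: 'a point set) = 2"
    by (simp add: O_g_Int_line_inf)
  ultimately show ?thesis
    using hyperoval_O_g unfolding translation_hyperoval_def by blast
qed

section \<open>Inequivalence with the standard hyperoval\<close>

lemma not_transitive_centre_Slope_0:
  assumes "n \<ge> 5"
  shows "\<not> transitive_centre knuth (Slope 0)"
proof
  assume tc: "transitive_centre knuth (Slope 0)"
  obtain s a :: 'a where sa: "s \<noteq> 0" "a \<noteq> 0" "s \<noteq> a" "Tr s = 0" "Tr a = 0"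
    using two_nonzero_in_common_kernel[of 0] assms by (metis zero_neq_one)
  define c where "c = a / s"
  have c: "c \<noteq> 0" "c \<noteq> 1" and a: "a = c * s"
    using sa by (auto simp: c_def)
  obtain b where b: "\<And>x u. knuth u s = knuth x s + knuth x a \<Longrightarrow> knuth u b = knuth x a"
    using knuth.transitive_centre_Slope_0_identity[OF tc sa(1), of a] sa(3)
    by (metis add_eq_0_iff_eq)
  \<comment> \<open>For such \<open>x\<close> all products with \<open>s\<close> and
    \<open>a\<close> are field products, so \<open>u = x + c * x\<close> satisfies the premise of
    \<open>b\<close>. The left side is constant in \<open>x\<close>, so two values of
    \<open>x\<close> will force \<open>Tr b = 0\<close>.\<close>
  have on_kernel: "a + (b + c * b) = Tr b * (x * (1 + c)\<^sup>2)"
    if "x \<noteq> 0" "Tr x = 0" "Tr (c * x) = 0" for x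
  proof -
    have "knuth (x + c * x) b = knuth x a"
      using that sa(4,5) by (intro b) (simp add: knuth_Tr_0_left Tr_add a algebra_simps)
    hence "x * (1 + c) * b + (x * (1 + c))\<^sup>2 * Tr b = x * a"
      using that sa(5) by (simp add: knuth_Tr_0_left Tr_add distrib_left mult.commute)
    hence "x * (a + (b + c * b)) = x * (Tr b * (x * (1 + c)\<^sup>2))"
      by (simp add: eq_add_iff[symmetric] algebra_simps power2_eq_square)
    thus ?thesis using that(1) by (metis mult_left_cancel)
  qed
  obtain x y where xy: "x \<noteq> 0" "y \<noteq> 0" "x \<noteq> y" "Tr x = 0" "Tr y = 0"
      "Tr (c * x) = 0" "Tr (c * y) = 0"
    using two_nonzero_in_common_kernel[OF c(2) assms] by metis
  have "Tr b * (x * (1 + c)\<^sup>2) = Tr b * (y * (1 + c)\<^sup>2)"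
    using on_kernel[of x] on_kernel[of y] xy by simp
  hence Tr_b: "Tr b = 0"
    using xy(3) c(2) by (auto simp: add_eq_0_iff_eq)
  hence "a + (b + c * b) = 0"
    using on_kernel[of x] xy by simp
  hence ab: "a = b + c * b"
    by (simp only: add_eq_0_iff_eq)
  obtain w where w: "Tr w = 0" "Tr (c * w) = 1"
    using Tr_mult_dichotomy[OF c] by blast
  \<comment> \<open>Now \<open>u\<close> has trace 1, so \<open>knuth u s\<close> acquires the extra
    term \<open>s^2\<close>; the summand \<open>s\<close> in \<open>u\<close> cancels it. On the
    \<open>b\<close> side the same terms leave \<open>s * b + b^2 = 0\<close>, hence
    \<open>b = s\<close>, and \<open>a = b + c * b\<close> becomes \<open>a = s + a\<close>.\<close>
  have "knuth (w + (c * w + s)) b = knuth w a"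
    using w sa(4,5) by (intro b) (simp add: knuth_Tr_0_right Tr_add a algebra_simps power2_eq_square)
  hence "(w + (c * w + s)) * b + b\<^sup>2 = w * (b + c * b)"
    using w sa(4,5) Tr_b ab by (simp add: knuth_Tr_0_right Tr_add)
  hence "b * (s + b) = 0"
    by (simp add: algebra_simps power2_eq_square)
  moreover have "b \<noteq> 0"
    using ab sa(2) by auto
  ultimately have "b = s"
    by (simp add: add_eq_0_iff_eq)
  thus False using ab a sa(1) by simp
qed

lemma not_equivalent_O_g_O_s:
  assumes "n \<ge> 5"
  shows "\<not> equivalent_in_plane knuth (O_g :: 'a point set) (O_s knuth)"
proof
  assume "equivalent_in_plane knuth (O_g :: 'a point set) (O_s knuth)"
  then obtain f where f: "collineation knuth f" "f ` (O_g :: 'a point set) = O_s knuth"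
    by (auto simp: equivalent_in_plane_def)
  have "Vertex \<in> f ` O_g"
    unfolding f(2) by (simp add: O_s_def)
  then obtain P where P: "P \<in> O_g" "f P = Vertex"
    by (metis imageE)
  have "inv_into UNIV f Vertex = P"
    using f(1) P(2) by (metis bij_is_inj collineation_def inv_f_f)
  hence "transitive_centre knuth P"
    using transitive_centre_image[OF collineation_inv[OF f(1)] knuth.transitive_centre_Vertex] by simp
  moreover have "P \<noteq> Vertex"
    using P(1) by (auto simp: O_g_def)
  ultimately show False
    using knuth.transitive_centre_Slope_0 not_transitive_centre_Slope_0[OF assms] by blast
qed

end

(* For n = 1 and n = 3 the plane is Desarguesian of order 2 or 8, and there O_g and O_s are
   equivalent; hence the bound on n in the second conjunct. *)
theorem theorem2p5:
  fixes n :: nat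
  assumes "odd n"
    and "CARD('a::{field,finite}) = 2 ^ n"
  shows "translation_hyperoval (knuth_mult n) (O_g :: 'a point set) \<and>
    (n \<ge> 5 \<longrightarrow>
      \<not> equivalent_in_plane (knuth_mult n) (O_g :: 'a point set) (O_s (knuth_mult n)))"
proof -
  interpret odd_binary_field n "TYPE('a)"
    using assms by unfold_locales
  show ?thesis
    using translation_hyperoval_O_g not_equivalent_O_g_O_s by blast
qed

end
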